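(* Let $f:\mathbb{R}^d\to\mathbb{R}$ be convex and $T:\mathbb{R}^d\to\mathbb{R}^d$ firmly nonexpansive with $\mathrm{Fix}\,T\neq\emptyset$, and assume that the solution set $\mathcal{S}$ of the problem of minimizing $f$ over $\mathrm{Fix}\,T$ is nonempty, with optimal value $f^*$. Let $a\in(0,1)$, let $\tau\in\mathbb{N}_0$, and let $\{\tau_n\}_{n=0}^\infty\subset\mathbb{N}_0$ satisfy $0\le\tau_n\le\tau$ for all $n\in\mathbb{N}_0$. Let $\alpha>0$ satisfy $(3+2(\tau+1)^2)\alpha^a<8$ and put $\alpha_n=\frac{\alpha}{n+1}$ for $n\in\mathbb{N}_0$. Let $\{\mathbf{x}_n\}$ be generated by the Fixed-Point Delayed Subgradient Method: $\mathbf{x}_0=\mathbf{x}_{-1}=\cdots=\mathbf{x}_{-\tau}\in\mathbb{R}^d$ and $$\mathbf{x}_{n+1}=T\mathbf{x}_n-\alpha_n\widetilde{\nabla}f(T\mathbf{x}_{n-\tau_n}),\qquad n\in\mathbb{N}_0.$$ Suppose that there is $C>0$ with $\max\{\|\widetilde{\nabla}f(\mathbf{x}_n)\|,\|\widetilde{\nabla}f(T\mathbf{x}_n)\|\}\le C$ for all $n\in\mathbb{N}_0$. Then, for all $N\in\mathbb{N}_0$ and all $\mathbf{x}^*\in\mathcal{S}$, $$\min_{0\le n\le N}f(\mathbf{x}_{n+1})-f^*\le\frac{\|\mathbf{x}_0-\mathbf{x}^*\|^2+4C^2\alpha^2+40C^2\left(\frac{\alpha^{2-a}(2-a)}{1-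a}\right)}{2\alpha}\left(\frac{1}{\log(N+2)}\right).$$
   Context: $\mathbb{R}^d$ is Euclidean space with inner product $\langle\cdot,\cdot\rangle$ and induced norm $\|\cdot\|$; $\mathbb{N}_0$ is the set of nonnegative integers; $\log$ is the natural logarithm. $T$ is firmly nonexpansive if $\langle T\mathbf{x}-T\mathbf{y},\mathbf{x}-\mathbf{y}\rangle\ge\|T\mathbf{x}-T\mathbf{y}\|^2$ for all $\mathbf{x},\mathbf{y}\in\mathbb{R}^d$. $\mathrm{Fix}\,T=\{\mathbf{x}\in\mathbb{R}^d:T\mathbf{x}=\mathbf{x}\}$. $\mathcal{S}$ is the set of minimizers of $f$ over $\mathrm{Fix}\,T$ and $f^*$ is the minimum value. For each $\mathbf{x}\in\mathbb{R}^d$, $\widetilde{\nabla}f(\mathbf{x})$ denotes a (chosen) subgradient of $f$ at $\mathbf{x}$, i.e. an element of $\partial f(\mathbf{x})=\{\mathbf{g}\in\mathbb{R}^d:\langle\mathbf{g},\mathbf{y}-\mathbf{x}\rangle\le f(\mathbf{y})-f(\mathbf{x})\ \forall\mathbf{y}\in\mathbb{R}^d\}$. *)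

theory Defs
  imports "HOL-Analysis.Analysis"
begin

definition firmly_nonexpansive :: "('a::real_inner \<Rightarrow> 'a) \<Rightarrow> bool" where
  "firmly_nonexpansive T \<longleftrightarrow>
     (\<forall>x y. inner (T x - T y) (x - y) \<ge> (norm (T x - T y))\<^sup>2)"

definition Fix :: "('a \<Rightarrow> 'a) \<Rightarrow> 'a set" where
  "Fix T = {x. T x = x}"

definition subdifferential :: "('a::real_inner \<Rightarrow> real) \<Rightarrow> 'a \<Rightarrow> 'a set" where
  "subdifferential f x = {g. \<forall>y. inner g (y - x) \<le> f y - f x}"

definition minimizers_on :: "('a \<Rightarrow> real) \<Rightarrow> 'a set \<Rightarrow> 'a set" where
  "minimizers_on f X = {x. is_arg_min f (\<lambda>y. y \<in> X) x}"

text \<open>As an infimum of reals this is meaningful only for a nonempty set on which the function is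
  bounded below; it is the minimum value as soon as a minimizer exists.\<close>

definition optimal_value :: "('a \<Rightarrow> real) \<Rightarrow> 'a set \<Rightarrow> real" where
  "optimal_value f X = (INF x\<in>X. f x)"

text \<open>The iterates are indexed by integers, since a delayed index \<open>n - \<tau>\<^sub>n\<close> may be as small as
  \<open>-\<tau>\<close>; \<open>x\<close> is unconstrained (and never used) below \<open>-\<tau>\<close>. The function \<open>g\<close> is the chosen
  subgradient selection and \<open>s\<close> the step-size sequence.\<close>

definition fixed_point_delayed_subgradient_method ::
  "('a::real_vector \<Rightarrow> 'a) \<Rightarrow> ('a \<Rightarrow> 'a) \<Rightarrow> (nat \<Rightarrow> real) \<Rightarrow> nat \<Rightarrow> (nat \<Rightarrow> nat) \<Rightarrow> (int \<Rightarrow> 'a) \<Rightarrow> bool"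
where
  "fixed_point_delayed_subgradient_method T g s \<tau> delay x \<longleftrightarrow>
     (\<forall>k. - int \<tau> \<le> k \<and> k \<le> 0 \<longrightarrow> x k = x 0) \<and>
     (\<forall>n::nat. x (int n + 1) = T (x (int n)) - s n *\<^sub>R g (T (x (int n - int (delay n)))))"

end

theory Submission
  imports Defs
begin

text \<open>
  Fix a minimizer \<open>p\<close> of \<open>f\<close> over \<open>Fix T\<close>, write \<open>r\<^sub>n = \<parallel>x\<^sub>n - T x\<^sub>n\<parallel>\<close> and \<open>s\<^sub>n\<close> for the step
  sizes. Expanding \<open>\<parallel>x\<^sub>n\<^sub>+\<^sub>1 - p\<parallel>\<^sup>2\<close>, firm nonexpansiveness yields a decrease by \<open>r\<^sub>n\<^sup>2\<close> and the
  subgradient inequalities yield a decrease by \<open>2 s\<^sub>n (f x\<^sub>n\<^sub>+\<^sub>1 - f p)\<close>, up to an error of order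
  \<open>s\<^sub>n\<^sup>2\<close> and a delay error \<open>4 s\<^sub>n C \<parallel>T x\<^sub>n - T x\<^sub>m\<parallel>\<close>, where \<open>m\<close> is the delayed index
  (\<open>fixed_point_subgradient_step\<close>).

  The delayed point lies at most \<open>\<tau>\<close> iterations back, and one iteration moves by at most
  \<open>r\<^sub>k + s\<^sub>k C\<close> (\<open>delay_drift_le\<close>). Young's inequality with weight \<open>\<tau> + 1\<close> turns the products
  \<open>s\<^sub>n r\<^sub>k\<close> and \<open>s\<^sub>n s\<^sub>k\<close> into \<open>r\<^sub>k\<^sup>2 / (\<tau> + 1)\<close> plus multiples of \<open>s\<^sub>n\<^sup>2\<close> and \<open>s\<^sub>k\<^sup>2\<close>. Each index \<open>k\<close> lies in the windows of at
  most \<open>\<tau>\<close> later indices (\<open>sum_delay_windows_le\<close>), so after summation the terms \<open>r\<^sub>k\<^sup>2\<close> are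
  absorbed by the decrease coming from firm nonexpansiveness. What remains, for arbitrary step sizes, is
  \<open>2 \<Sum> s\<^sub>n (f x\<^sub>n\<^sub>+\<^sub>1 - f p) \<le> \<parallel>x\<^sub>0 - p\<parallel>\<^sup>2 + 4 (\<tau> + 1)\<^sup>2 C\<^sup>2 \<Sum> s\<^sub>n\<^sup>2\<close>
  (\<open>delayed_subgradient_weighted_gap\<close>).

  For \<open>s\<^sub>n = \<alpha> / (n + 1)\<close> the weights sum to at least \<open>\<alpha> ln (N + 2)\<close> and their squares to at most
  \<open>2 \<alpha>\<^sup>2\<close>. The hypothesis on \<open>\<alpha>\<close> bounds \<open>(\<tau> + 1)\<^sup>2\<close> by \<open>4 \<alpha> powr (-a)\<close>, so the right-hand
  side is at most \<open>\<parallel>x\<^sub>0 - p\<parallel>\<^sup>2 + 32 C\<^sup>2 \<alpha> powr (2 - a)\<close>; dividing by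
  \<open>2 \<alpha> ln (N + 2)\<close> bounds the smallest gap when it is nonnegative.
\<close>

lemma firmly_nonexpansive_nonexpansive:
  assumes "firmly_nonexpansive T"
  shows "norm (T x - T y) \<le> norm (x - y)"
proof (cases "T x = T y")
  case False
  have "norm (T x - T y) * norm (T x - T y) \<le> inner (T x - T y) (x - y)"
    using assms by (simp add: firmly_nonexpansive_def power2_eq_square)
  also have "\<dots> \<le> norm (T x - T y) * norm (x - y)"
    by (rule norm_cauchy_schwarz)
  finally show ?thesis using False by simp
qed simp

lemma firmly_nonexpansive_Fix_decrease:
  assumes "firmly_nonexpansive T" "p \<in> Fix T"
  shows "(norm (T x - p))\<^sup>2 \<le> (norm (x - p))\<^sup>2 - (norm (x - T x))\<^sup>2"
proof -
  have "(norm (T x - T p))\<^sup>2 \<le> inner (T x - T p) (x - p)"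
    using assms(1) by (simp add: firmly_nonexpansive_def)
  then have "(norm (T x - p))\<^sup>2 \<le> inner (T x - p) (x - p)"
    using assms(2) by (simp add: Fix_def)
  then show ?thesis
    by (simp add: power2_norm_eq_inner inner_diff_left inner_diff_right inner_commute)
qed

text \<open>The subgradient is taken at an arbitrary point \<open>z\<close>, so the step also covers stale
  information. The staleness \<open>\<parallel>T x - z\<parallel>\<close> enters twice, each time with factor
  \<open>2 s C\<close>: when \<open>g z\<close> is tested against \<open>T x - p\<close> instead of \<open>z - p\<close>, and when \<open>f x'\<close> is compared
  with \<open>f z\<close> through the subgradient at \<open>x'\<close>.\<close>

lemma fixed_point_subgradient_step:
  assumes T: "firmly_nonexpansive T" and p: "p \<in> Fix T"
    and g: "\<And>z. g z \<in> subdifferential f z"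
    and s: "0 \<le> s"
    and x': "x' = T x - s *\<^sub>R g z"
    and Cz: "norm (g z) \<le> C" and Cx': "norm (g x') \<le> C"
  shows "(norm (x' - p))\<^sup>2 + 2 * s * (f x' - f p)
    \<le> (norm (x - p))\<^sup>2 - (norm (x - T x))\<^sup>2 + 3 * s\<^sup>2 * C\<^sup>2 + 4 * s * C * norm (T x - z)"
proof -
  define \<delta> where "\<delta> = norm (T x - z)"
  have C: "0 \<le> C" using Cz norm_ge_zero order_trans by blast
  have sg: "s\<^sup>2 * (norm (g z))\<^sup>2 \<le> s\<^sup>2 * C\<^sup>2"
    using Cz by (intro mult_left_mono power_mono) auto
  have expand: "(norm (x' - p))\<^sup>2
      = (norm (T x - p))\<^sup>2 - 2 * s * inner (g z) (T x - p) + s\<^sup>2 * (norm (g z))\<^sup>2"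
    unfolding x' power2_norm_eq_inner
    by (simp add: algebra_simps inner_commute power2_eq_square)
  have pz: "inner (g z) (p - z) \<le> f p - f z" and zx': "inner (g x') (z - x') \<le> f z - f x'"
    using g by (auto simp: subdifferential_def)
  have a: "- (inner (g z) (T x - z)) \<le> C * \<delta>"
  proof -
    have "inner (g z) (z - T x) \<le> norm (g z) * norm (z - T x)" by (rule norm_cauchy_schwarz)
    also have "\<dots> \<le> C * \<delta>"
      unfolding \<delta>_def using Cz by (simp add: norm_minus_commute mult_right_mono)
    finally show ?thesis by (simp add: inner_diff_right)
  qed
  have b: "inner (g x') (x' - z) \<le> C * (\<delta> + s * C)"
  proof -
    have "norm (x' - z) \<le> norm (T x - z) + norm (s *\<^sub>R g z)"
      unfolding x' using norm_triangle_ineq4[of "T x - z" "s *\<^sub>R g z"]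
      by (simp add: algebra_simps)
    also have "\<dots> \<le> \<delta> + s * C" using s Cz by (simp add: \<delta>_def mult_left_mono)
    finally have "norm (g x') * norm (x' - z) \<le> C * (\<delta> + s * C)"
      using Cx' C by (intro mult_mono) auto
    then show ?thesis using norm_cauchy_schwarz[of "g x'" "x' - z"] by linarith
  qed
  have "f x' - f p \<le> inner (g z) (T x - p) + 2 * C * \<delta> + s * C\<^sup>2"
    using pz zx' a b by (simp add: inner_diff_right algebra_simps power2_eq_square)
  then have "2 * s * (f x' - f p) \<le> 2 * s * (inner (g z) (T x - p) + 2 * C * \<delta> + s * C\<^sup>2)"
    using s by (intro mult_left_mono) auto
  then show ?thesis
    using expand sg firmly_nonexpansive_Fix_decrease[OF T p, of x]
    by (simp add: \<delta>_def[symmetric] algebra_simps power2_eq_square)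
qed

lemma norm_diff_le_sum_steps:
  fixes X :: "nat \<Rightarrow> 'a::real_normed_vector"
  assumes "m \<le> n"
  shows "norm (X n - X m) \<le> (\<Sum>k\<in>{m..<n}. norm (X (Suc k) - X k))"
  using sum_Suc_diff'[OF assms, of X] norm_sum[of "\<lambda>k. X (Suc k) - X k" "{m..<n}"] by simp

text \<open>The window of summation is enlarged from the actual delay \<open>d\<close> to the uniform bound \<open>\<tau>\<close>, so
  that it no longer depends on the delay sequence and the windows can be counted.\<close>

lemma delay_drift_le:
  fixes X :: "nat \<Rightarrow> 'a::real_inner"
  assumes T: "firmly_nonexpansive T"
    and step: "\<And>n. X (Suc n) = T (X n) - s n *\<^sub>R v n"
    and s: "\<And>n. 0 \<le> s n" and C: "\<And>n. norm (v n) \<le> C"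
    and d: "d \<le> \<tau>"
  shows "norm (T (X n) - T (X (n - d))) \<le> (\<Sum>k\<in>{n-\<tau>..<n}. norm (X k - T (X k)) + s k * C)"
proof -
  have move: "norm (X (Suc k) - X k) \<le> norm (X k - T (X k)) + s k * C" for k
  proof -
    have "X (Suc k) - X k = - (X k - T (X k)) - s k *\<^sub>R v k" by (simp add: step)
    then have "norm (X (Suc k) - X k) \<le> norm (X k - T (X k)) + norm (s k *\<^sub>R v k)"
      by (metis norm_minus_cancel norm_triangle_ineq4)
    also have "norm (s k *\<^sub>R v k) \<le> s k * C" using s C by (simp add: mult_left_mono)
    finally show ?thesis by simp
  qed
  have C0: "0 \<le> C" using C[of 0] norm_ge_zero order_trans by blast
  have "norm (T (X n) - T (X (n - d))) \<le> norm (X n - X (n - d))"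
    using T by (rule firmly_nonexpansive_nonexpansive)
  also have "\<dots> \<le> (\<Sum>k\<in>{n-d..<n}. norm (X (Suc k) - X k))"
    by (rule norm_diff_le_sum_steps) simp
  also have "\<dots> \<le> (\<Sum>k\<in>{n-d..<n}. norm (X k - T (X k)) + s k * C)"
    by (intro sum_mono move)
  also have "\<dots> \<le> (\<Sum>k\<in>{n-\<tau>..<n}. norm (X k - T (X k)) + s k * C)"
    using d s C0 by (intro sum_mono2) auto
  finally show ?thesis .
qed

text \<open>After exchanging the sums, \<open>h k\<close> is counted once for every \<open>n\<close> with \<open>k < n \<le> k + \<tau>\<close>.\<close>

lemma sum_delay_windows_le:
  fixes h :: "nat \<Rightarrow> real"
  assumes h: "\<And>k. 0 \<le> h k"
  shows "(\<Sum>n\<le>N. \<Sum>k\<in>{n-\<tau>..<n}. h k) \<le> real \<tau> * (\<Sum>k\<le>N. h k)"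
proof -
  have "(\<Sum>n\<le>N. \<Sum>k\<in>{n-\<tau>..<n}. h k) = (\<Sum>n\<le>N. \<Sum>k\<in>{k. k \<le> N \<and> n - \<tau> \<le> k \<and> k < n}. h k)"
    by (intro sum.cong) auto
  also have "\<dots> = (\<Sum>k\<le>N. \<Sum>n\<in>{n. n \<le> N \<and> n - \<tau> \<le> k \<and> k < n}. h k)"
    using sum.swap_restrict[of "{..N}" "{..N}" "\<lambda>n k. h k" "\<lambda>n k. n - \<tau> \<le> k \<and> k < n"]
    by simp
  also have "\<dots> \<le> (\<Sum>k\<le>N. real \<tau> * h k)"
  proof (rule sum_mono)
    fix k
    have "card {n. n \<le> N \<and> n - \<tau> \<le> k \<and> k < n} \<le> card {k<..k+\<tau>}"
      by (intro card_mono) auto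
    then have "real (card {n. n \<le> N \<and> n - \<tau> \<le> k \<and> k < n}) \<le> real \<tau>" by simp
    then show "(\<Sum>n\<in>{n. n \<le> N \<and> n - \<tau> \<le> k \<and> k < n}. h k) \<le> real \<tau> * h k"
      using h by (simp add: mult_right_mono)
  qed
  finally show ?thesis by (simp add: sum_distrib_left)
qed

text \<open>Young's inequality, with the weight chosen so that \<open>\<tau>\<close> copies of the \<open>r\<^sup>2\<close> term stay
  below one full \<open>r\<^sup>2\<close>; \<open>\<tau> + 1\<close> rather than \<open>\<tau>\<close> keeps the weight positive without delay.\<close>

lemma delay_term_young:
  fixes s t r C w :: real
  assumes "0 < w"
  shows "4 * s * C * (r + t * C) \<le> (r\<^sup>2 / w + 2 * C\<^sup>2 * t\<^sup>2) + (4 * w + 2) * C\<^sup>2 * s\<^sup>2"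
proof -
  have "0 \<le> (r - 2 * w * s * C)\<^sup>2 / w" using assms by simp
  also have "\<dots> = r\<^sup>2 / w - 4 * s * C * r + 4 * w * C\<^sup>2 * s\<^sup>2"
    using assms by (simp add: field_simps power2_eq_square)
  finally have 1: "4 * s * C * r \<le> r\<^sup>2 / w + 4 * w * C\<^sup>2 * s\<^sup>2" by simp
  have "0 \<le> 2 * C\<^sup>2 * (s - t)\<^sup>2" by simp
  then have "4 * s * C * (t * C) \<le> 2 * C\<^sup>2 * t\<^sup>2 + 2 * C\<^sup>2 * s\<^sup>2"
    by (simp add: algebra_simps power2_eq_square)
  with 1 show ?thesis by (simp add: algebra_simps)
qed

text \<open>The delayed index is a truncated difference: before time \<open>0\<close> the iterates are constantly
  \<open>X 0\<close>.\<close>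

lemma delayed_subgradient_weighted_gap:
  fixes X :: "nat \<Rightarrow> 'a::real_inner"
  assumes T: "firmly_nonexpansive T" and p: "p \<in> Fix T"
    and g: "\<And>z. g z \<in> subdifferential f z"
    and s: "\<And>n. 0 \<le> s n"
    and step: "\<And>n. X (Suc n) = T (X n) - s n *\<^sub>R g (T (X (n - d n)))"
    and d: "\<And>n. d n \<le> \<tau>"
    and CX: "\<And>n. norm (g (X n)) \<le> C" and CTX: "\<And>n. norm (g (T (X n))) \<le> C"
  shows "2 * (\<Sum>n\<le>N. s n * (f (X (Suc n)) - f p))
    \<le> (norm (X 0 - p))\<^sup>2 + 4 * (real \<tau> + 1)\<^sup>2 * C\<^sup>2 * (\<Sum>n\<le>N. (s n)\<^sup>2)"
proof -
  define D where "D n = (norm (X n - p))\<^sup>2" for n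
  define r where "r n = norm (X n - T (X n))" for n
  define h where "h k = (r k)\<^sup>2 / (real \<tau> + 1) + 2 * C\<^sup>2 * (s k)\<^sup>2" for k
  define S where "S = (\<Sum>n\<le>N. (s n)\<^sup>2)"
  define R where "R = (\<Sum>n\<le>N. (r n)\<^sup>2)"
  define K where "K = real \<tau> * ((4 * (real \<tau> + 1) + 2) * C\<^sup>2)"
  have C0: "0 \<le> C" using CX[of 0] norm_ge_zero order_trans by blast
  have S0: "0 \<le> S" and R0: "0 \<le> R" by (simp_all add: S_def R_def sum_nonneg)
  have one_step: "2 * (s n * (f (X (Suc n)) - f p))
      \<le> (D n - D (Suc n)) - (r n)\<^sup>2 + (3 * C\<^sup>2 + K) * (s n)\<^sup>2 + (\<Sum>k\<in>{n-\<tau>..<n}. h k)" for n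
  proof -
    let ?W = "{n-\<tau>..<n}"
    have "4 * s n * C * norm (T (X n) - T (X (n - d n)))
        \<le> 4 * s n * C * (\<Sum>k\<in>?W. r k + s k * C)"
      unfolding r_def using s[of n] C0
      by (intro mult_left_mono delay_drift_le[where v = "\<lambda>n. g (T (X (n - d n)))", OF T step s CTX d]) auto
    also have "\<dots> \<le> (\<Sum>k\<in>?W. h k + (4 * (real \<tau> + 1) + 2) * C\<^sup>2 * (s n)\<^sup>2)"
      unfolding sum_distrib_left h_def by (intro sum_mono delay_term_young) simp
    also have "\<dots> = (\<Sum>k\<in>?W. h k) + real (card ?W) * ((4 * (real \<tau> + 1) + 2) * C\<^sup>2 * (s n)\<^sup>2)"
      by (simp add: sum.distrib)
    also have "\<dots> \<le> (\<Sum>k\<in>?W. h k) + real \<tau> * ((4 * (real \<tau> + 1) + 2) * C\<^sup>2 * (s n)\<^sup>2)"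
      by (intro add_left_mono mult_right_mono) auto
    finally have "4 * s n * C * norm (T (X n) - T (X (n - d n))) \<le> (\<Sum>k\<in>?W. h k) + K * (s n)\<^sup>2"
      by (simp add: K_def mult.assoc)
    with fixed_point_subgradient_step[OF T p g s step CTX CX, of n]
    show ?thesis by (simp add: D_def r_def algebra_simps)
  qed
  have "2 * (\<Sum>n\<le>N. s n * (f (X (Suc n)) - f p))
      \<le> (\<Sum>n\<le>N. (D n - D (Suc n)) - (r n)\<^sup>2 + (3 * C\<^sup>2 + K) * (s n)\<^sup>2 + (\<Sum>k\<in>{n-\<tau>..<n}. h k))"
    unfolding sum_distrib_left by (intro sum_mono one_step)
  also have "\<dots> = (D 0 - D (Suc N)) - R + (3 * C\<^sup>2 + K) * S + (\<Sum>n\<le>N. \<Sum>k\<in>{n-\<tau>..<n}. h k)"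
    unfolding sum.distrib sum_subtractf R_def S_def sum_distrib_left[symmetric]
    using sum_telescope[of D N] by (simp add: sum_subtractf)
  also have "\<dots> \<le> (D 0 - D (Suc N)) - R + (3 * C\<^sup>2 + K) * S + real \<tau> * (\<Sum>k\<le>N. h k)"
    by (intro add_left_mono sum_delay_windows_le) (simp add: h_def)
  also have "(\<Sum>k\<le>N. h k) = R / (real \<tau> + 1) + 2 * C\<^sup>2 * S"
    by (simp add: h_def R_def S_def sum.distrib sum_divide_distrib sum_distrib_left)
  also have "(D 0 - D (Suc N)) - R + (3 * C\<^sup>2 + K) * S
        + real \<tau> * (R / (real \<tau> + 1) + 2 * C\<^sup>2 * S)
      \<le> D 0 + (3 + 4 * (real \<tau>)\<^sup>2 + 8 * real \<tau>) * C\<^sup>2 * S"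
  proof -
    have "real \<tau> * (R / (real \<tau> + 1)) \<le> R" using R0 by (simp add: field_simps)
    moreover have "0 \<le> D (Suc N)" by (simp add: D_def)
    ultimately show ?thesis by (simp add: K_def algebra_simps power2_eq_square)
  qed
  also have "\<dots> \<le> D 0 + 4 * (real \<tau> + 1)\<^sup>2 * C\<^sup>2 * S"
    using S0 by (intro add_left_mono mult_right_mono) (auto simp: power2_eq_square algebra_simps)
  finally show ?thesis by (simp add: D_def S_def)
qed

lemma sum_inverse_squares_le:
  "(\<Sum>n\<le>N. 1 / (real n + 1)\<^sup>2) \<le> 2 - 1 / (real N + 1)"
proof (induction N)
  case (Suc N)
  have "1 / (real N + 2)\<^sup>2 \<le> 1 / ((real N + 1) * (real N + 2))"
    by (intro divide_left_mono) (auto simp: power2_eq_square)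
  also have "\<dots> = 1 / (real N + 1) - 1 / (real N + 2)" by (simp add: field_simps)
  finally show ?case using Suc by (simp add: add.commute)
qed simp

lemma optimal_value_eq:
  assumes "p \<in> minimizers_on f A"
  shows "optimal_value f A = f p"
proof -
  have "p \<in> A" "\<And>y. y \<in> A \<Longrightarrow> f p \<le> f y"
    using assms by (auto simp: minimizers_on_def is_arg_min_linorder)
  then show ?thesis unfolding optimal_value_def by (intro cInf_eq_minimum) auto
qed

theorem corollary3p6:
  fixes f :: "real ^ 'd \<Rightarrow> real"
    and T :: "real ^ 'd \<Rightarrow> real ^ 'd"
    and g :: "real ^ 'd \<Rightarrow> real ^ 'd"
    and x :: "int \<Rightarrow> real ^ 'd"
    and \<tau> :: nat
    and delay :: "nat \<Rightarrow> nat"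
    and a \<alpha> C :: real
  assumes "convex_on UNIV f"
    and "firmly_nonexpansive T"
    and "Fix T \<noteq> {}"
    and "minimizers_on f (Fix T) \<noteq> {}"
    and "\<And>z. g z \<in> subdifferential f z"
    and "0 < a" and "a < 1"
    and "\<And>n. delay n \<le> \<tau>"
    and "\<alpha> > 0"
    and "(3 + 2 * (real \<tau> + 1)\<^sup>2) * \<alpha> powr a < 8"
    and "fixed_point_delayed_subgradient_method T g (\<lambda>n. \<alpha> / (real n + 1)) \<tau> delay x"
    and "C > 0"
    and "\<And>n::nat. max (norm (g (x (int n)))) (norm (g (T (x (int n))))) \<le> C"
  shows "\<forall>N::nat. \<forall>xstar \<in> minimizers_on f (Fix T).
    (MIN n\<in>{0..N}. f (x (int n + 1))) - optimal_value f (Fix T)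
      \<le> ((norm (x 0 - xstar))\<^sup>2 + 4 * C\<^sup>2 * \<alpha>\<^sup>2
            + 40 * C\<^sup>2 * (\<alpha> powr (2 - a) * (2 - a) / (1 - a))) / (2 * \<alpha>)
          * (1 / ln (real N + 2))"
proof (intro allI ballI)
  fix N :: nat and p
  assume p: "p \<in> minimizers_on f (Fix T)"
  define X where "X n = x (int n)" for n
  define s where "s n = \<alpha> / (real n + 1)" for n
  define gap where "gap = (MIN n\<in>{0..N}. f (x (int n + 1))) - f p"
  define B where "B = (norm (x 0 - p))\<^sup>2 + 4 * C\<^sup>2 * \<alpha>\<^sup>2
    + 40 * C\<^sup>2 * (\<alpha> powr (2 - a) * (2 - a) / (1 - a))"
  have pT: "p \<in> Fix T" using p by (auto simp: minimizers_on_def is_arg_min_def)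
  have delayed: "x (int n - int (delay n)) = X (n - delay n)" for n
  proof (cases "delay n \<le> n")
    case False
    have "- int \<tau> \<le> int n - int (delay n)" using assms(8)[of n] by linarith
    moreover have "int n - int (delay n) \<le> 0" using False by linarith
    ultimately have "x (int n - int (delay n)) = x 0"
      using assms(11) unfolding fixed_point_delayed_subgradient_method_def by blast
    then show ?thesis using False by (simp add: X_def)
  qed (simp add: X_def of_nat_diff)
  have step: "X (Suc n) = T (X n) - s n *\<^sub>R g (T (X (n - delay n)))" for n
  proof -
    have "x (int n + 1) = T (x (int n)) - s n *\<^sub>R g (T (x (int n - int (delay n))))"
      using assms(11) unfolding fixed_point_delayed_subgradient_method_def s_def by blast
    then show ?thesis by (simp only: delayed) (simp add: X_def add.commute)
  qed
  have s0: "0 \<le> s n" for n using assms(9) by (simp add: s_def)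
  have gap_le: "gap \<le> f (X (Suc n)) - f p" if "n \<le> N" for n
  proof -
    have "(MIN n\<in>{0..N}. f (x (int n + 1))) \<le> f (x (int n + 1))"
      using that by (intro Min_le) auto
    then show ?thesis by (simp add: gap_def X_def add.commute)
  qed
  have ratio: "1 \<le> (2 - a) / (1 - a)" using assms(6,7) by (simp add: field_simps)
  have sum_sq: "(\<Sum>n\<le>N. (s n)\<^sup>2) \<le> 2 * \<alpha>\<^sup>2"
  proof -
    have "(\<Sum>n\<le>N. (s n)\<^sup>2) = \<alpha>\<^sup>2 * (\<Sum>n\<le>N. 1 / (real n + 1)\<^sup>2)"
      by (simp add: s_def power_divide sum_distrib_left)
    also have "\<dots> \<le> \<alpha>\<^sup>2 * 2"
    proof (rule mult_left_mono)
      have "0 \<le> 1 / (real N + 1)" by simp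
      then show "(\<Sum>n\<le>N. 1 / (real n + 1)\<^sup>2) \<le> 2"
        using sum_inverse_squares_le[of N] by linarith
    qed simp
    finally show ?thesis by simp
  qed
  have delay_cost: "(real \<tau> + 1)\<^sup>2 * \<alpha>\<^sup>2 \<le> 4 * \<alpha> powr (2 - a)"
  proof -
    have "\<alpha>\<^sup>2 = \<alpha> powr a * \<alpha> powr (2 - a)"
      using assms(9) by (simp flip: powr_add)
    then have "(real \<tau> + 1)\<^sup>2 * \<alpha>\<^sup>2 = ((real \<tau> + 1)\<^sup>2 * \<alpha> powr a) * \<alpha> powr (2 - a)"
      by simp
    also have "\<dots> \<le> 4 * \<alpha> powr (2 - a)"
    proof (rule mult_right_mono)
      have "0 \<le> \<alpha> powr a" by simp
      then show "(real \<tau> + 1)\<^sup>2 * \<alpha> powr a \<le> 4" using assms(10) unfolding distrib_right by linarith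
    qed simp
    finally show ?thesis .
  qed
  have weighted: "2 * (\<Sum>n\<le>N. s n * (f (X (Suc n)) - f p)) \<le> B"
  proof -
    have "2 * (\<Sum>n\<le>N. s n * (f (X (Suc n)) - f p))
        \<le> (norm (X 0 - p))\<^sup>2 + 4 * (real \<tau> + 1)\<^sup>2 * C\<^sup>2 * (\<Sum>n\<le>N. (s n)\<^sup>2)"
      using assms(13)
      by (intro delayed_subgradient_weighted_gap[OF assms(2) pT assms(5) s0 step assms(8)])
        (auto simp: X_def)
    also have "\<dots> \<le> (norm (X 0 - p))\<^sup>2 + 4 * (real \<tau> + 1)\<^sup>2 * C\<^sup>2 * (2 * \<alpha>\<^sup>2)"
      using sum_sq by (intro add_left_mono mult_left_mono) auto
    also have "\<dots> = (norm (X 0 - p))\<^sup>2 + 8 * C\<^sup>2 * ((real \<tau> + 1)\<^sup>2 * \<alpha>\<^sup>2)"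
      by simp
    also have "\<dots> \<le> (norm (X 0 - p))\<^sup>2 + 8 * C\<^sup>2 * (4 * \<alpha> powr (2 - a))"
      using delay_cost by (intro add_left_mono mult_left_mono) auto
    also have "\<dots> \<le> B"
    proof -
      have "\<alpha> powr (2 - a) * 1 \<le> \<alpha> powr (2 - a) * ((2 - a) / (1 - a))"
        using ratio by (intro mult_left_mono) auto
      then have "32 * C\<^sup>2 * (\<alpha> powr (2 - a))
          \<le> 40 * C\<^sup>2 * (\<alpha> powr (2 - a) * (2 - a) / (1 - a))"
        by (intro mult_mono) auto
      moreover have "0 \<le> 4 * C\<^sup>2 * \<alpha>\<^sup>2" by simp
      ultimately show ?thesis unfolding B_def X_def of_nat_0 by linarith
    qed
    finally show ?thesis .
  qed
  have L: "0 < ln (real N + 2)" by simp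
  have "gap \<le> B / (2 * \<alpha>) * (1 / ln (real N + 2))"
  proof (cases "0 \<le> gap")
    case True
    have "ln (real N + 2) \<le> harm (Suc N)"
      using ln_le_harm[of "Suc N"] by (simp add: add.commute)
    also have "harm (Suc N) = (\<Sum>n\<le>N. 1 / (real n + 1))"
      by (induction N) (simp_all add: harm_expand(1) harm_Suc divide_inverse add.commute)
    finally have "2 * \<alpha> * gap * ln (real N + 2) \<le> 2 * \<alpha> * gap * (\<Sum>n\<le>N. 1 / (real n + 1))"
      using True assms(9) by (intro mult_left_mono) auto
    also have "\<dots> = 2 * (\<Sum>n\<le>N. s n * gap)"
      by (simp add: s_def sum_distrib_left sum_distrib_right mult_ac)
    also have "\<dots> \<le> 2 * (\<Sum>n\<le>N. s n * (f (X (Suc n)) - f p))"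
      using gap_le s0 by (intro mult_left_mono sum_mono) auto
    also note weighted
    finally show ?thesis using L assms(9) by (simp add: field_simps)
  next
    \<comment> \<open>The iterates need not lie in \<open>Fix T\<close>, so \<open>f\<close> may drop below the constrained minimum.\<close>
    case False
    have "0 \<le> B" using assms(6,7) by (auto simp: B_def)
    then have "0 \<le> B / (2 * \<alpha>) * (1 / ln (real N + 2))" using L assms(9) by simp
    then show ?thesis using False by linarith
  qed
  then show "(MIN n\<in>{0..N}. f (x (int n + 1))) - optimal_value f (Fix T)
      \<le> ((norm (x 0 - p))\<^sup>2 + 4 * C\<^sup>2 * \<alpha>\<^sup>2
            + 40 * C\<^sup>2 * (\<alpha> powr (2 - a) * (2 - a) / (1 - a))) / (2 * \<alpha>)
          * (1 / ln (real N + 2))"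
    by (simp only: gap_def B_def optimal_value_eq[OF p])
qed

end
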